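(* Let $H\colon T^{*}\mathbb{R}^{d}\cong\mathbb{R}^{2d}\to\mathbb{R}$ be a smooth Hamiltonian. The semiexplicit integrator (defined in the context) preserves any linear and any quadratic invariant of the Hamiltonian system $\dot z=\mathbb{J}\,DH(z)$. That is, let $\Delta t>0$ and $z_{n}=(q_{n},p_{n})\in\mathbb{R}^{2d}$, and suppose that the integrator step $z_{n}\mapsto z_{n+1}$ with time step $\Delta t$ is defined, i.e. $\mu\in\mathbb{R}^{2d}$ satisfies $\hat\Phi_{\Delta t}(\zeta_{n}+A^{T}\mu)+A^{T}\mu\in\ker A$ with $\zeta_{n}=(q_{n},q_{n},p_{n},p_{n})$, and $z_{n+1}=(q_{n+1},p_{n+1})$ is given by $(q_{n+1},q_{n+1},p_{n+1},p_{n+1})=\hat\Phi_{\Delta t}(\zeta_{n}+A^{T}\mu)+A^{T}\mu$. Then: (1) for every $a\in\mathbb{R}^{2d}$ such that $L_{a}(z)=a^{T}z$ is an invariant of $\dot z=\mathbb{J}\,DH(z)$, one has $L_{a}(z_{n+1})=L_{a}(z_{n})$; (2) for every symmetric $\kappa\in\mathbb{R}^{2d\times 2d}$ such that $Q_{\kappa}(z)=\tfrac12 z^{T}\kappa z$ is an invariant of $\dot z=\mathbb{J}\,DH(z)$, one has $Q_{\kappa}(z_{n+1})=Q_{\kappa}(z_{n})$.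
   Context: Write $z=(q,p)\in\mathbb{R}^{d}\times\mathbb{R}^{d}$ (tuples denote column vectors), $\mathbb{J}=\begin{bmatrix}0&I_{d}\\-I_{d}&0\end{bmatrix}$, and $DH$ for the gradient (column vector) of $H$. A function $F$ on $\mathbb{R}^{2d}$ is an invariant of $\dot z=\mathbb{J}\,DH(z)$ if it is constant along all solutions; for smooth $F$ this is equivalent to $DF(z)^{T}\mathbb{J}\,DH(z)=0$ for all $z\in\mathbb{R}^{2d}$. Extended phase space: $T^{*}\mathbb{R}^{2d}\cong\mathbb{R}^{4d}$ with elements $\zeta=(q,x,p,y)$, $q,x,p,y\in\mathbb{R}^{d}$. Write $\eta=(q,y)\in\mathbb{R}^{2d}$ and $\xi=(x,p)\in\mathbb{R}^{2d}$, so that $\zeta$ is identified with the pair $(\eta,\xi)$. For $t\in\mathbb{R}$ define maps of $\mathbb{R}^{4d}$ to itself by $$\hat\Phi^{A}_{t}\colon(\eta,\xi)\mapsto(\eta,\ \xi+t\,\mathbb{J}\,DH(\eta)),\qquad \hat\Phi^{B}_{t}\colon(\eta,\xi)\mapsto(\eta+t\,\mathbb{J}\,DH(\xi),\ \xi).$$ Pihajoki's integrator with time step $\Delta t$ is $\hat\Phi_{\Delta t}=\hat\Phi^{A}_{\Delta t/2}\circ\hat\Phi^{B}_{\Delta t}\circ\hat\Phi^{A}_{\Delta t/2}$. Let $$A=\begin{bmatrix}I_{d}&-I_{d}&0&0\\0&0&I_{d}&-I_{d}\end{bmatrix}\in\mathbb{R}^{2d\times4d},$$ acting on $\zeta=(q,x,p,y)$,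 so that $\ker A=\{(q,q,p,p): q,p\in\mathbb{R}^{d}\}$. Semiexplicit integrator: given $z_{n}=(q_{n},p_{n})$, set $\zeta_{n}=(q_{n},q_{n},p_{n},p_{n})$; find $\mu\in\mathbb{R}^{2d}$ such that $\hat\Phi_{\Delta t}(\zeta_{n}+A^{T}\mu)+A^{T}\mu\in\ker A$; set $\hat\zeta_{n}=\zeta_{n}+A^{T}\mu$, $\hat\zeta_{n+1}=\hat\Phi_{\Delta t}(\hat\zeta_{n})$, $\zeta_{n+1}=\hat\zeta_{n+1}+A^{T}\mu$, which has the form $(q_{n+1},q_{n+1},p_{n+1},p_{n+1})$; and set $z_{n+1}=(q_{n+1},p_{n+1})$. *)

theory Defs
  imports "HOL-Analysis.Analysis"
begin

text \<open>
  \<open>\<real>\<^sup>2\<^sup>d\<close> is \<^typ>\<open>real ^ ('d + 'd)\<close> with \<open>d = CARD('d)\<close>, and \<open>\<real>\<^sup>4\<^sup>d\<close> is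
  \<^typ>\<open>real ^ (('d + 'd) + ('d + 'd))\<close>. Since a matrix is the vector of its rows,
  \<open>vjoin\<close> also stacks two matrices on top of each other.
\<close>

definition vjoin :: "'a ^ 'm \<Rightarrow> 'a ^ 'n \<Rightarrow> 'a ^ ('m::finite + 'n::finite)" where
  "vjoin u v = (\<chi> k. case k of Inl i \<Rightarrow> u $ i | Inr j \<Rightarrow> v $ j)"

definition vfst :: "'a ^ ('m::finite + 'n::finite) \<Rightarrow> 'a ^ 'm" where
  "vfst w = (\<chi> i. w $ Inl i)"

definition vsnd :: "'a ^ ('m::finite + 'n::finite) \<Rightarrow> 'a ^ 'n" where
  "vsnd w = (\<chi> j. w $ Inr j)"

definition hcat :: "'a ^ 'n ^ 'm \<Rightarrow> 'a ^ 'k ^ 'm \<Rightarrow> 'a ^ ('n::finite + 'k::finite) ^ 'm" where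
  "hcat M N = (\<chi> i. vjoin (M $ i) (N $ i))"

lemma vfst_vjoin [simp]: "vfst (vjoin u v) = u"
  and vsnd_vjoin [simp]: "vsnd (vjoin u v) = v"
  and vjoin_vfst_vsnd [simp]: "vjoin (vfst w) (vsnd w) = w"
  by (auto simp: vec_eq_iff vjoin_def vfst_def vsnd_def split: sum.split)

lemma vjoin_eq_iff [simp]: "vjoin u v = vjoin u' v' \<longleftrightarrow> u = u' \<and> v = v'"
  by (metis vfst_vjoin vsnd_vjoin)

definition mat_ker :: "real ^ 'n ^ 'm \<Rightarrow> (real ^ 'n) set" where
  "mat_ker M = {v. M *v v = 0}"

text \<open>
  \<open>C\<^sup>0\<close> means continuous, and \<open>C\<^sup>k\<^sup>+\<^sup>1\<close> means differentiable everywhere with all first partial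
  derivatives of class \<open>C\<^sup>k\<close>.
\<close>

primrec Ck :: "nat \<Rightarrow> ('a::euclidean_space \<Rightarrow> real) \<Rightarrow> bool" where
  "Ck 0 f \<longleftrightarrow> continuous_on UNIV f"
| "Ck (Suc k) f \<longleftrightarrow>
     (\<forall>x. f differentiable at x) \<and>
     (\<forall>b\<in>Basis. Ck k (\<lambda>x. frechet_derivative f (at x) b))"

definition smooth :: "('a::euclidean_space \<Rightarrow> real) \<Rightarrow> bool" where
  "smooth f \<longleftrightarrow> (\<forall>k. Ck k f)"

definition gradient :: "(real ^ 'n \<Rightarrow> real) \<Rightarrow> real ^ 'n \<Rightarrow> real ^ 'n" where
  "gradient f x = (\<chi> i. frechet_derivative f (at x) (axis i 1))"

lemma gradient_GDERIV:
  assumes "f differentiable at x"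
  shows "GDERIV f x :> gradient f x"
proof -
  let ?D = "frechet_derivative f (at x)"
  have D: "(f has_derivative ?D) (at x)"
    using assms frechet_derivative_works by blast
  then have lin: "linear ?D"
    by (rule has_derivative_linear)
  have "?D h = h \<bullet> gradient f x" for h
  proof -
    have "?D h = ?D (\<Sum>i\<in>UNIV. h $ i *\<^sub>R axis i 1)"
      using basis_expansion[of h] by (simp add: scalar_mult_eq_scaleR)
    also have "\<dots> = h \<bullet> gradient f x"
      by (simp add: linear_sum[OF lin] linear_cmul[OF lin] inner_vec_def gradient_def)
    finally show ?thesis .
  qed
  then have "?D = (\<lambda>h. h \<bullet> gradient f x)"
    by (rule ext)
  with D show ?thesis
    by (simp add: gderiv_def)
qed

definition symp_mat :: "real ^ ('d::finite + 'd) ^ ('d + 'd)" where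
  "symp_mat = vjoin (hcat 0 (mat 1)) (hcat (- mat 1) 0)"

definition hamiltonian_field ::
  "(real ^ ('d::finite + 'd) \<Rightarrow> real) \<Rightarrow> real ^ ('d + 'd) \<Rightarrow> real ^ ('d + 'd)" where
  "hamiltonian_field H z = symp_mat *v gradient H z"

text \<open>
  Solutions need not exist for all times, so they are taken on arbitrary open intervals.
\<close>

definition hamiltonian_solution ::
  "(real ^ ('d::finite + 'd) \<Rightarrow> real) \<Rightarrow> real set \<Rightarrow> (real \<Rightarrow> real ^ ('d + 'd)) \<Rightarrow> bool" where
  "hamiltonian_solution H T z \<longleftrightarrow>
     open T \<and> is_interval T \<and>
     (\<forall>t\<in>T. (z has_vector_derivative hamiltonian_field H (z t)) (at t))"

definition hamiltonian_invariant ::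
  "(real ^ ('d::finite + 'd) \<Rightarrow> real) \<Rightarrow> (real ^ ('d + 'd) \<Rightarrow> real) \<Rightarrow> bool" where
  "hamiltonian_invariant H F \<longleftrightarrow>
     (\<forall>T z. hamiltonian_solution H T z \<longrightarrow> (\<forall>s\<in>T. \<forall>t\<in>T. F (z s) = F (z t)))"

definition linear_fn :: "real ^ 'n \<Rightarrow> real ^ 'n \<Rightarrow> real" where
  "linear_fn a z = a \<bullet> z"

definition quadratic_fn :: "real ^ 'n ^ 'n \<Rightarrow> real ^ 'n \<Rightarrow> real" where
  "quadratic_fn \<kappa> z = 1 / 2 * (z \<bullet> (\<kappa> *v z))"

text \<open>
  Points of the extended phase space are \<open>\<zeta> = (q, x, p, y)\<close>; the identification of \<open>\<zeta>\<close> with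
  \<open>(\<eta>, \<xi>)\<close> pairs the outer components \<open>\<eta> = (q, y)\<close> and the inner components \<open>\<xi> = (x, p)\<close>.
\<close>

type_synonym 'd ext_phase = "real ^ (('d + 'd) + ('d + 'd))"

definition ext_point ::
  "real ^ 'd \<Rightarrow> real ^ 'd \<Rightarrow> real ^ 'd \<Rightarrow> real ^ 'd \<Rightarrow> ('d::finite) ext_phase" where
  "ext_point q x p y = vjoin (vjoin q x) (vjoin p y)"

definition eta_part :: "('d::finite) ext_phase \<Rightarrow> real ^ ('d + 'd)" where
  "eta_part \<zeta> = vjoin (vfst (vfst \<zeta>)) (vsnd (vsnd \<zeta>))"

definition xi_part :: "('d::finite) ext_phase \<Rightarrow> real ^ ('d + 'd)" where
  "xi_part \<zeta> = vjoin (vsnd (vfst \<zeta>)) (vfst (vsnd \<zeta>))"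

definition of_eta_xi :: "real ^ ('d + 'd) \<Rightarrow> real ^ ('d + 'd) \<Rightarrow> ('d::finite) ext_phase" where
  "of_eta_xi \<eta> \<xi> = ext_point (vfst \<eta>) (vfst \<xi>) (vsnd \<xi>) (vsnd \<eta>)"

lemma eta_xi_ext_point [simp]:
  "eta_part (ext_point q x p y) = vjoin q y"
  "xi_part (ext_point q x p y) = vjoin x p"
  "of_eta_xi (vjoin q y) (vjoin x p) = ext_point q x p y"
  by (simp_all add: eta_part_def xi_part_def of_eta_xi_def ext_point_def)

definition flow_A ::
  "(real ^ ('d::finite + 'd) \<Rightarrow> real) \<Rightarrow> real \<Rightarrow> 'd ext_phase \<Rightarrow> 'd ext_phase" where
  "flow_A H t \<zeta> =
     of_eta_xi (eta_part \<zeta>) (xi_part \<zeta> + t *\<^sub>R hamiltonian_field H (eta_part \<zeta>))"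

definition flow_B ::
  "(real ^ ('d::finite + 'd) \<Rightarrow> real) \<Rightarrow> real \<Rightarrow> 'd ext_phase \<Rightarrow> 'd ext_phase" where
  "flow_B H t \<zeta> =
     of_eta_xi (eta_part \<zeta> + t *\<^sub>R hamiltonian_field H (xi_part \<zeta>)) (xi_part \<zeta>)"

definition pihajoki ::
  "(real ^ ('d::finite + 'd) \<Rightarrow> real) \<Rightarrow> real \<Rightarrow> 'd ext_phase \<Rightarrow> 'd ext_phase" where
  "pihajoki H \<Delta>t = flow_A H (\<Delta>t / 2) \<circ> flow_B H \<Delta>t \<circ> flow_A H (\<Delta>t / 2)"

definition constraint_mat :: "real ^ (('d::finite + 'd) + ('d + 'd)) ^ ('d + 'd)" where
  "constraint_mat =
     vjoin (hcat (hcat (mat 1) (- mat 1)) 0)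
           (hcat 0 (hcat (mat 1) (- mat 1)))"

definition diag_embed :: "real ^ ('d + 'd) \<Rightarrow> ('d::finite) ext_phase" where
  "diag_embed z = ext_point (vfst z) (vfst z) (vsnd z) (vsnd z)"

text \<open>
  A step is a relation, as the multiplier \<open>\<mu>\<close> need neither exist nor be unique.
\<close>

definition semiexplicit_step ::
  "(real ^ ('d::finite + 'd) \<Rightarrow> real) \<Rightarrow> real \<Rightarrow> real ^ ('d + 'd) \<Rightarrow>
   real ^ ('d + 'd) \<Rightarrow> real ^ ('d + 'd) \<Rightarrow> bool" where
  "semiexplicit_step H \<Delta>t \<mu> z z' \<longleftrightarrow>
     (let \<zeta>' = pihajoki H \<Delta>t (diag_embed z + transpose constraint_mat *v \<mu>)
                 + transpose constraint_mat *v \<mu>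
      in \<zeta>' \<in> mat_ker constraint_mat \<and> diag_embed z' = \<zeta>')"

lemma mat_vjoin_mult: "vjoin M N *v v = vjoin (M *v v) (N *v v)"
  by (auto simp: vec_eq_iff matrix_vector_mult_def vjoin_def split: sum.split)

lemma hcat_mult: "hcat M N *v vjoin u v = M *v u + N *v v"
  for M :: "real ^ 'n ^ 'm" and N :: "real ^ 'k ^ 'm"
  by (simp add: vec_eq_iff matrix_vector_mult_def hcat_def vjoin_def
      flip: UNIV_Plus_UNIV add: sum.Plus)

lemma neg_mat_one_mult: "(- mat 1) *v v = - (v :: real ^ 'n)"
  using matrix_vector_mult_diff_rdistrib[of 0 "mat 1" v] by simp

lemma symp_mat_mult: "symp_mat *v vjoin u v = vjoin v (- u)"
  by (simp add: symp_mat_def mat_vjoin_mult hcat_mult neg_mat_one_mult)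

lemma constraint_mat_mult: "constraint_mat *v ext_point q x p y = vjoin (q - x) (p - y)"
  by (simp add: constraint_mat_def ext_point_def mat_vjoin_mult hcat_mult neg_mat_one_mult)

lemma mat_ker_constraint_mat: "mat_ker constraint_mat = range (diag_embed :: real ^ ('n::finite + 'n) \<Rightarrow> 'n ext_phase)"
proof -
  have zero: "(0 :: real ^ ('n + 'n)) = vjoin 0 0"
    by (auto simp: vec_eq_iff vjoin_def split: sum.split)
  have "\<zeta> \<in> range diag_embed" if "constraint_mat *v \<zeta> = 0" for \<zeta> :: "'n ext_phase"
  proof -
    obtain q x p y where \<zeta>: "\<zeta> = ext_point q x p y"
      by (metis ext_point_def vjoin_vfst_vsnd)
    with that have "x = q" "y = p"
      by (simp_all add: constraint_mat_mult zero)
    then have "\<zeta> = diag_embed (vjoin q p)"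
      by (simp add: \<zeta> diag_embed_def)
    then show ?thesis
      by blast
  qed
  moreover have "constraint_mat *v diag_embed z = 0" for z :: "real ^ ('n + 'n)"
    by (simp add: diag_embed_def constraint_mat_mult zero)
  ultimately show ?thesis
    by (auto simp: mat_ker_def)
qed

end

theory Submission
  imports Defs
begin

text \<open>
  In the coordinates \<open>(\<eta>, \<xi>)\<close> every point \<open>A\<^sup>T \<mu>\<close> has the form \<open>(m, - m)\<close>, so a step starts
  at \<open>(z + m, z - m)\<close> and ends at \<open>(z' - m, z' + m)\<close>. If \<open>a \<bullet> z\<close> is an invariant, then both
  \<open>a \<bullet> \<eta>\<close> and \<open>a \<bullet> \<xi>\<close> are preserved by Pihajoki's integrator, and the average of the two
  conservation laws is free of \<open>m\<close>. If \<open>z \<bullet> \<kappa> z / 2\<close> is an invariant, then the bilinear form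
  \<open>\<xi> \<bullet> \<kappa> \<eta>\<close> is preserved, and \<open>(z - m) \<bullet> \<kappa> (z + m) = z \<bullet> \<kappa> z - m \<bullet> \<kappa> m\<close> has the same
  correction term at both ends. Invariance along solutions is turned into the pointwise condition
  on the vector field by solving the initial value problem locally.
\<close>

subsection \<open>Local solutions of initial value problems\<close>

text \<open>Picard-Lindeloef: on a short time interval the integral operator is a contraction of the
  complete space of bounded continuous functions, and its Banach fixed point solves the
  equation.\<close>

lemma local_solution_lipschitz_UNIV:
  fixes f :: "'a::euclidean_space \<Rightarrow> 'a"
  assumes lip: "L-lipschitz_on UNIV f"
  obtains \<phi> and \<delta> :: real where "\<delta> > 0" "\<phi> 0 = z"
    "\<And>t. t \<in> {-\<delta><..<\<delta>} \<Longrightarrow> (\<phi> has_vector_derivative f (\<phi> t)) (at t)"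
proof -
  have L: "L \<ge> 0"
    using lip by (rule lipschitz_on_nonneg)
  \<comment> \<open>The contraction factor below becomes \<open>3 * L / (6 * L + 6)\<close>, which
    is less than 1/2; the summand 6 keeps the denominator positive when
    \<open>L = 0\<close>.\<close>
  define \<delta> where "\<delta> = 1 / (6 * L + 6)"
  have \<delta>: "\<delta> > 0" and small: "3 * \<delta> * L < 1"
    using L by (simp_all add: \<delta>_def field_simps)
  have cont_f: "continuous_on UNIV f"
    using lip by (rule lipschitz_on_continuous_on)
  have cont_comp: "continuous_on S (\<lambda>s. f (\<phi> s))" if "continuous_on S \<phi>" for S and \<phi> :: "real \<Rightarrow> 'a"
    using continuous_on_compose2[OF cont_f that] by simp
  \<comment> \<open>The integral starts at the left endpoint so that negative times are covered too;
    subtracting \<open>I \<phi> 0\<close> in \<open>P\<close> moves the base point to time 0.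
    Clamping extends \<open>P \<phi>\<close> constantly outside the interval, which makes it bounded
    and continuous on the whole line.\<close>
  define I where "I \<phi> t = integral {-\<delta>..t} (\<lambda>s. f (apply_bcontfun \<phi> s))" for \<phi> t
  define P where "P \<phi> t = z + I \<phi> (clamp (-\<delta>) \<delta> t) - I \<phi> 0" for \<phi> t
  have clamp: "clamp (-\<delta>) \<delta> t \<in> {-\<delta>..\<delta>}" for t
    using clamp_in_interval[of "-\<delta>" \<delta> t] \<delta> by simp
  have "continuous_on {-\<delta>..\<delta>} (I \<phi>)" for \<phi>
    unfolding I_def
    by (intro indefinite_integral_continuous_1 integrable_continuous_real cont_comp
        continuous_on_apply_bcontfun)
  then have "continuous_on (cbox (-\<delta>) \<delta>) (\<lambda>t. z + I \<phi> t - I \<phi> 0)" for \<phi>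
    by (auto intro!: continuous_intros)
  then have "P \<phi> \<in> bcontfun" for \<phi>
    unfolding P_def bcontfun_def
    by (intro CollectI conjI clamp_continuous_on[where f = "\<lambda>t. z + I \<phi> t - I \<phi> 0"]
        clamp_bounded[where f = "\<lambda>t. z + I \<phi> t - I \<phi> 0"]
        compact_imp_bounded compact_continuous_image compact_cbox)
  then have BP: "apply_bcontfun (Bcontfun (P \<phi>)) = P \<phi>" for \<phi>
    by (rule Bcontfun_inverse)
  have I_diff: "norm (I \<phi> t - I \<psi> t) \<le> L * dist \<phi> \<psi> * (t + \<delta>)" if "t \<in> {-\<delta>..\<delta>}" for \<phi> \<psi> t
  proof -
    have "I \<phi> t - I \<psi> t = integral {-\<delta>..t} (\<lambda>s. f (\<phi> s) - f (\<psi> s))"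
      unfolding I_def
      by (subst Henstock_Kurzweil_Integration.integral_diff)
        (auto intro!: integrable_continuous_real cont_comp)
    also have "norm \<dots> \<le> (L * dist \<phi> \<psi>) * (t - (-\<delta>))"
    proof (rule integral_bound)
      show "continuous_on {-\<delta>..t} (\<lambda>s. f (\<phi> s) - f (\<psi> s))"
        by (intro continuous_intros cont_comp continuous_on_apply_bcontfun)
      show "norm (f (\<phi> s) - f (\<psi> s)) \<le> L * dist \<phi> \<psi>" for s
      proof -
        have "norm (f (\<phi> s) - f (\<psi> s)) \<le> L * dist (\<phi> s) (\<psi> s)"
          using lipschitz_onD[OF lip, of "\<phi> s" "\<psi> s"] by (simp add: dist_norm)
        also have "\<dots> \<le> L * dist \<phi> \<psi>"
          by (intro mult_left_mono dist_bounded L)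
        finally show ?thesis .
      qed
    qed (use that in auto)
    finally show ?thesis by simp
  qed
  have "dist (Bcontfun (P \<phi>)) (Bcontfun (P \<psi>)) \<le> 3 * \<delta> * L * dist \<phi> \<psi>" for \<phi> \<psi>
  proof (rule dist_bound)
    fix t
    let ?c = "clamp (-\<delta>) \<delta> t"
    have "dist (P \<phi> t) (P \<psi> t) = norm ((I \<phi> ?c - I \<psi> ?c) - (I \<phi> 0 - I \<psi> 0))"
      by (simp add: P_def dist_norm algebra_simps)
    also have "\<dots> \<le> L * dist \<phi> \<psi> * (?c + \<delta>) + L * dist \<phi> \<psi> * (0 + \<delta>)"
      using clamp[of t] \<delta>
      by (intro order_trans[OF norm_triangle_ineq4] add_mono I_diff) auto
    \<comment> \<open>The factor 3 arises here: the clamped time contributes at most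
      \<open>2 * \<delta>\<close> and the base point 0 contributes \<open>\<delta>\<close>.\<close>
    also have "\<dots> \<le> L * dist \<phi> \<psi> * (\<delta> + \<delta>) + L * dist \<phi> \<psi> * (0 + \<delta>)"
      using clamp[of t] L by (intro add_mono mult_left_mono) auto
    finally show "dist (Bcontfun (P \<phi>) t) (Bcontfun (P \<psi>) t) \<le> 3 * \<delta> * L * dist \<phi> \<psi>"
      by (simp add: BP algebra_simps)
  qed
  then have "\<exists>!\<phi>. Bcontfun (P \<phi>) = \<phi>"
    using \<delta> L small by (intro banach_fix_type[of "3 * \<delta> * L"]) auto
  then obtain \<phi> where "Bcontfun (P \<phi>) = \<phi>" by blast
  then have fixed_pt: "\<phi> t = P \<phi> t" for t
    by (metis BP)
  have eq: "\<phi> t = z + I \<phi> t - I \<phi> 0" if "t \<in> {-\<delta>..\<delta>}" for t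
    using that fixed_pt[of t] clamp_cancel_cbox[of t "-\<delta>" \<delta>] by (simp add: P_def)
  show thesis
  proof (rule that[OF \<delta>, of "apply_bcontfun \<phi>"])
    show "\<phi> 0 = z"
      using eq[of 0] \<delta> by simp
    fix t assume t: "t \<in> {-\<delta><..<\<delta>}"
    have "(I \<phi> has_vector_derivative f (\<phi> t)) (at t within {-\<delta>..\<delta>})"
      unfolding I_def
      using t by (intro integral_has_vector_derivative cont_comp continuous_on_apply_bcontfun) auto
    then have "(I \<phi> has_vector_derivative f (\<phi> t)) (at t)"
      using t at_within_Icc_at[of "-\<delta>" t \<delta>] by simp
    then have "((\<lambda>s. z + I \<phi> s - I \<phi> 0) has_vector_derivative f (\<phi> t)) (at t)"
      by (auto intro!: derivative_eq_intros)
    then show "(apply_bcontfun \<phi> has_vector_derivative f (\<phi> t)) (at t)"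
      by (rule has_vector_derivative_transform_within_open[of _ _ _ "{-\<delta><..<\<delta>}"])
        (use t eq in auto)
  qed
qed

lemma local_solution_lipschitz_cball:
  fixes f :: "'a::euclidean_space \<Rightarrow> 'a"
  assumes r: "r > 0" and lip: "L-lipschitz_on (cball z r) f"
  obtains \<phi> and \<delta> :: real where "\<delta> > 0" "\<phi> 0 = z"
    "\<And>t. t \<in> {-\<delta><..<\<delta>} \<Longrightarrow> (\<phi> has_vector_derivative f (\<phi> t)) (at t)"
proof -
  \<comment> \<open>Composing with the nonexpansive projection onto the ball makes the field globally Lipschitz;
    near time 0 the solution stays inside the ball and does not notice the change.\<close>
  let ?p = "closest_point (cball z r)"
  have p: "?p x \<in> cball z r" for x
    using r by (intro closest_point_in_set) auto
  have "1-lipschitz_on UNIV ?p"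
    using r closest_point_lipschitz[OF convex_cball closed_cball, of z r]
    by (intro lipschitz_onI) auto
  moreover have "L-lipschitz_on (range ?p) f"
    using p by (intro lipschitz_on_subset[OF lip]) auto
  ultimately have "(L * 1)-lipschitz_on UNIV (\<lambda>x. f (?p x))"
    by (rule lipschitz_on_compose2)
  then obtain \<phi> and \<delta> :: real where \<delta>: "\<delta> > 0" and init: "\<phi> 0 = z"
    and deriv: "\<And>t. t \<in> {-\<delta><..<\<delta>} \<Longrightarrow> (\<phi> has_vector_derivative f (?p (\<phi> t))) (at t)"
    using local_solution_lipschitz_UNIV[where z = z] by blast
  have "isCont \<phi> 0"
    using deriv[of 0] \<delta> has_vector_derivative_continuous by auto
  then obtain \<epsilon> where \<epsilon>: "\<epsilon> > 0" and near: "\<And>t. dist t 0 < \<epsilon> \<Longrightarrow> dist (\<phi> t) z < r"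
    using r init unfolding continuous_at_eps_delta by metis
  show thesis
  proof (rule that[of "min \<delta> \<epsilon>" \<phi>])
    fix t assume t: "t \<in> {- min \<delta> \<epsilon><..<min \<delta> \<epsilon>}"
    then have "dist t 0 < \<epsilon>"
      by auto
    then have "\<phi> t \<in> cball z r"
      using near[of t] by (simp add: dist_commute)
    then have "?p (\<phi> t) = \<phi> t"
      by (rule closest_point_self)
    then show "(\<phi> has_vector_derivative f (\<phi> t)) (at t)"
      using deriv[of t] t by auto
  qed (use \<delta> \<epsilon> init in auto)
qed

subsection \<open>The vector field of a smooth Hamiltonian\<close>

text \<open>Continuous partial derivatives are bounded on a compact set, hence so is the operator
  norm of the derivative; convexity then allows the mean value inequality.\<close>

lemma Ck_1_lipschitz_on_compact:
  fixes f :: "'a::euclidean_space \<Rightarrow> real"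
  assumes f: "Ck (Suc 0) f" and "compact S" "convex S"
  obtains L where "L-lipschitz_on S f"
proof -
  let ?D = "\<lambda>x. frechet_derivative f (at x)"
  have D: "(f has_derivative ?D x) (at x)" for x
    using f frechet_derivative_works by auto
  have "\<exists>B. \<forall>x\<in>S. norm (?D x b) \<le> B" if "b \<in> Basis" for b
  proof -
    have "continuous_on S (\<lambda>x. ?D x b)"
      using f that by (auto intro: continuous_on_subset)
    then have "bounded ((\<lambda>x. ?D x b) ` S)"
      using \<open>compact S\<close> by (intro compact_imp_bounded compact_continuous_image)
    then show ?thesis
      by (auto simp: bounded_iff)
  qed
  then obtain B where B: "\<And>b x. b \<in> Basis \<Longrightarrow> x \<in> S \<Longrightarrow> norm (?D x b) \<le> B b"
    by metis
  \<comment> \<open>Absolute values keep \<open>C\<close> nonnegative even for empty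
    \<open>S\<close>, where the bounds \<open>B b\<close> are arbitrary.\<close>
  define C where "C = (\<Sum>b\<in>Basis. \<bar>B b\<bar>)"
  have C: "C \<ge> 0"
    unfolding C_def by (intro sum_nonneg) auto
  have "onorm (?D x) \<le> C" if x: "x \<in> S" for x
  proof (rule onorm_bound[OF C])
    fix v
    have lin: "linear (?D x)"
      using D by (rule has_derivative_linear)
    have "?D x v = ?D x (\<Sum>b\<in>Basis. (v \<bullet> b) *\<^sub>R b)"
      by (simp add: euclidean_representation)
    also have "\<dots> = (\<Sum>b\<in>Basis. (v \<bullet> b) *\<^sub>R ?D x b)"
      by (simp add: linear_sum[OF lin] linear_cmul[OF lin])
    also have "norm \<dots> \<le> (\<Sum>b\<in>Basis. \<bar>B b\<bar> * norm v)"
    proof (rule sum_norm_le)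
      fix b :: 'a assume b: "b \<in> Basis"
      have "\<bar>v \<bullet> b\<bar> * \<bar>?D x b\<bar> \<le> norm v * \<bar>B b\<bar>"
        using B[OF b x] Basis_le_norm[OF b, of v] by (intro mult_mono) auto
      then show "norm ((v \<bullet> b) *\<^sub>R ?D x b) \<le> \<bar>B b\<bar> * norm v"
        by (simp add: abs_mult mult.commute)
    qed
    finally show "norm (?D x v) \<le> C * norm v"
      by (simp add: C_def sum_distrib_right)
  qed
  then have "C-lipschitz_on S f"
    using D C \<open>convex S\<close>
    by (intro bounded_derivative_imp_lipschitz[where f' = ?D]) (auto intro: has_derivative_at_withinI)
  then show thesis ..
qed

lemma bounded_linear_lipschitz_on:
  assumes "bounded_linear f"
  shows "(onorm f)-lipschitz_on S f"
proof (rule lipschitz_onI)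
  show "dist (f x) (f y) \<le> onorm f * dist x y" for x y
    using onorm[OF assms, of "x - y"]
    by (simp add: dist_norm linear_diff[OF bounded_linear.linear[OF assms]])
qed (rule onorm_pos_le[OF assms])

text \<open>The components of the gradient are of class C1, hence Lipschitz. Bounding the norm by
  the l1 norm adds up their constants, and \<open>symp_mat\<close> acts as a bounded linear
  map.\<close>

lemma hamiltonian_field_lipschitz_on_compact:
  fixes H :: "real ^ ('d::finite + 'd) \<Rightarrow> real"
  assumes "smooth H" and S: "compact S" "convex S"
  obtains L where "L-lipschitz_on S (hamiltonian_field H)"
proof -
  have "Ck (Suc (Suc 0)) H"
    using \<open>smooth H\<close> unfolding smooth_def by blast
  then have "Ck (Suc 0) (\<lambda>x. gradient H x $ i)" for i
    by (simp add: gradient_def axis_in_Basis_iff)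
  then have "\<exists>L. L-lipschitz_on S (\<lambda>x. gradient H x $ i)" for i
    using Ck_1_lipschitz_on_compact[OF _ S] by metis
  then obtain L where L: "\<And>i. (L i)-lipschitz_on S (\<lambda>x. gradient H x $ i)"
    by metis
  have "(\<Sum>i\<in>UNIV. L i)-lipschitz_on S (gradient H)"
  proof (rule lipschitz_onI)
    show "0 \<le> (\<Sum>i\<in>UNIV. L i)"
      using L by (intro sum_nonneg) (auto intro: lipschitz_on_nonneg)
    fix x y assume "x \<in> S" "y \<in> S"
    have "dist (gradient H x) (gradient H y)
        \<le> (\<Sum>i\<in>UNIV. \<bar>(gradient H x - gradient H y) $ i\<bar>)"
      unfolding dist_norm by (rule norm_le_l1_cart)
    also have "\<dots> \<le> (\<Sum>i\<in>UNIV. L i * dist x y)"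
      using lipschitz_onD[OF L \<open>x \<in> S\<close> \<open>y \<in> S\<close>] by (intro sum_mono) (simp add: dist_real_def)
    finally show "dist (gradient H x) (gradient H y) \<le> (\<Sum>i\<in>UNIV. L i) * dist x y"
      by (simp add: sum_distrib_right)
  qed
  then have "(onorm ((*v) symp_mat :: real ^ ('d + 'd) \<Rightarrow> _) * (\<Sum>i\<in>UNIV. L i))-lipschitz_on S
      (\<lambda>x. symp_mat *v gradient H x)"
    by (rule lipschitz_on_compose2) (rule bounded_linear_lipschitz_on[OF matrix_vector_mul_bounded_linear])
  then have "(onorm ((*v) symp_mat :: real ^ ('d + 'd) \<Rightarrow> _) * (\<Sum>i\<in>UNIV. L i))-lipschitz_on S
      (hamiltonian_field H)"
    by (simp add: hamiltonian_field_def)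
  then show thesis ..
qed

text \<open>\<open>F\<close> is constant along the local solution through \<open>z\<close>, so its
  chain-rule derivative at time 0 vanishes. A general \<open>F'\<close> serves linear and quadratic
  invariants alike.\<close>

lemma hamiltonian_invariant_imp_derivative_zero:
  assumes "smooth H" and inv: "hamiltonian_invariant H F"
    and F: "(F has_derivative F') (at z)"
  shows "F' (hamiltonian_field H z) = 0"
proof -
  \<comment> \<open>The field need not be globally Lipschitz; the radius 1 is arbitrary.\<close>
  obtain L where "L-lipschitz_on (cball z 1) (hamiltonian_field H)"
    using hamiltonian_field_lipschitz_on_compact[OF \<open>smooth H\<close> compact_cball convex_cball] .
  then obtain \<phi> and \<delta> :: real where \<delta>: "\<delta> > 0" and init: "\<phi> 0 = z"
    and deriv: "\<And>t. t \<in> {-\<delta><..<\<delta>} \<Longrightarrow> (\<phi> has_vector_derivative hamiltonian_field H (\<phi> t)) (at t)"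
    using local_solution_lipschitz_cball[OF zero_less_one] by blast
  have "hamiltonian_solution H {-\<delta><..<\<delta>} \<phi>"
    using deriv by (simp add: hamiltonian_solution_def is_interval_oo)
  then have const: "F (\<phi> t) = F z" if "t \<in> {-\<delta><..<\<delta>}" for t
    using inv that \<delta> init unfolding hamiltonian_invariant_def
    by (metis greaterThanLessThan_iff neg_less_0_iff_less)
  have "((F \<circ> \<phi>) has_vector_derivative F' (hamiltonian_field H z)) (at 0)"
    using vector_derivative_diff_chain_within[of \<phi> "hamiltonian_field H z" 0 UNIV F F']
      deriv[of 0] \<delta> init has_derivative_at_withinI[OF F] by simp
  moreover have "((F \<circ> \<phi>) has_vector_derivative 0) (at 0)"
    by (rule has_vector_derivative_transform_within_open[of "\<lambda>_. F z" _ _ "{-\<delta><..<\<delta>}"])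
      (use \<delta> const in auto)
  ultimately show ?thesis
    by (rule vector_derivative_unique_at)
qed

subsection \<open>The extended phase space\<close>

lemma vfst_add [simp]: "vfst (u + v) = vfst u + vfst v"
  and vsnd_add [simp]: "vsnd (u + v) = vsnd u + vsnd v"
  by (simp_all add: vec_eq_iff vfst_def vsnd_def)

lemma vjoin_add: "vjoin u v + vjoin u' v' = vjoin (u + u') (v + v')"
  by (simp add: vec_eq_iff vjoin_def split: sum.split)

lemma vjoin_uminus: "- vjoin u v = vjoin (- u) (- v :: real ^ _)"
  by (simp add: vec_eq_iff vjoin_def split: sum.split)

lemma eta_part_add [simp]: "eta_part (\<zeta> + \<zeta>') = eta_part \<zeta> + eta_part \<zeta>'"
  and xi_part_add [simp]: "xi_part (\<zeta> + \<zeta>') = xi_part \<zeta> + xi_part \<zeta>'"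
  by (simp_all add: eta_part_def xi_part_def vjoin_add)

lemma eta_part_of_eta_xi [simp]: "eta_part (of_eta_xi \<eta> \<xi>) = \<eta>"
  and xi_part_of_eta_xi [simp]: "xi_part (of_eta_xi \<eta> \<xi>) = \<xi>"
  by (simp_all add: of_eta_xi_def)

lemma eta_part_diag_embed [simp]: "eta_part (diag_embed z) = z"
  and xi_part_diag_embed [simp]: "xi_part (diag_embed z) = z"
  by (simp_all add: diag_embed_def)

lemma transpose_vjoin_mult:
  fixes M :: "real ^ 'k ^ 'm" and N :: "real ^ 'k ^ 'n"
  shows "transpose (vjoin M N) *v vjoin u v = transpose M *v u + transpose N *v v"
  by (simp add: vec_eq_iff matrix_vector_mult_def transpose_def vjoin_def
      flip: UNIV_Plus_UNIV add: sum.Plus)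

lemma transpose_hcat: "transpose (hcat M N) = vjoin (transpose M) (transpose N)"
  by (simp add: vec_eq_iff transpose_def hcat_def vjoin_def split: sum.split)

lemma transpose_neg_mat_one: "transpose (- mat 1 :: real ^ 'n ^ 'n) = - mat 1"
  by (simp add: vec_eq_iff transpose_def mat_def)

lemma transpose_zero: "transpose (0 :: real ^ 'n ^ 'm) = 0"
  by (simp add: vec_eq_iff transpose_def)

lemma transpose_constraint_mat_mult:
  "transpose constraint_mat *v vjoin u v = ext_point u (- u) v (- v)"
  by (simp add: constraint_mat_def transpose_vjoin_mult transpose_hcat mat_vjoin_mult
      transpose_neg_mat_one transpose_zero neg_mat_one_mult ext_point_def vjoin_add
      del: transpose_matrix_vector)

text \<open>For \<open>\<mu> = vjoin u v\<close> the correction is (u, -u, v, -v): its outer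
  components (u, -v) are the negatives of the inner ones (-u, v).\<close>

lemma xi_part_transpose_constraint_mat:
  "xi_part (transpose constraint_mat *v \<mu>) = - eta_part (transpose constraint_mat *v \<mu>)"
proof -
  obtain u v where "\<mu> = vjoin u v"
    by (metis vjoin_vfst_vsnd)
  then show ?thesis
    by (simp add: transpose_constraint_mat_mult vjoin_uminus del: transpose_matrix_vector)
qed

text \<open>Here \<open>m\<close> is the outer part of the correction. The same correction is added
  before and after the integrator, so solving for the integrator's output flips the sign of
  \<open>m\<close>.\<close>

lemma semiexplicit_step_eta_xi:
  assumes "semiexplicit_step H \<Delta>t \<mu> z z'"
  obtains m \<zeta> where "eta_part \<zeta> = z + m" "xi_part \<zeta> = z - m"
    "eta_part (pihajoki H \<Delta>t \<zeta>) = z' - m" "xi_part (pihajoki H \<Delta>t \<zeta>) = z' + m"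
proof -
  let ?c = "transpose constraint_mat *v \<mu>"
  let ?\<zeta> = "diag_embed z + ?c"
  have "diag_embed z' = pihajoki H \<Delta>t ?\<zeta> + ?c"
    using assms by (simp add: semiexplicit_step_def Let_def del: transpose_matrix_vector)
  then have "z' = eta_part (pihajoki H \<Delta>t ?\<zeta>) + eta_part ?c"
    and "z' = xi_part (pihajoki H \<Delta>t ?\<zeta>) + xi_part ?c"
    by (metis eta_part_add eta_part_diag_embed, metis xi_part_add xi_part_diag_embed)
  then show thesis
    by (intro that[of ?\<zeta> "eta_part ?c"])
      (simp_all add: xi_part_transpose_constraint_mat del: transpose_matrix_vector)
qed

section \<open>Conservation laws of the integrator\<close>

lemma pihajoki_preserves:
  assumes "\<And>t \<zeta>. G (flow_A H t \<zeta>) = G \<zeta>" and "\<And>t \<zeta>. G (flow_B H t \<zeta>) = G \<zeta>"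
  shows "G (pihajoki H \<Delta>t \<zeta>) = G \<zeta>"
  by (simp add: pihajoki_def assms)

lemma semiexplicit_step_preserves_linear:
  assumes field: "\<And>w. a \<bullet> hamiltonian_field H w = 0"
    and step: "semiexplicit_step H \<Delta>t \<mu> z z'"
  shows "a \<bullet> z' = a \<bullet> z"
proof -
  obtain m \<zeta> where \<zeta>: "eta_part \<zeta> = z + m" "xi_part \<zeta> = z - m"
      "eta_part (pihajoki H \<Delta>t \<zeta>) = z' - m" "xi_part (pihajoki H \<Delta>t \<zeta>) = z' + m"
    using semiexplicit_step_eta_xi[OF step] .
  have "a \<bullet> eta_part (pihajoki H \<Delta>t \<zeta>) = a \<bullet> eta_part \<zeta>"
    by (rule pihajoki_preserves) (simp_all add: flow_A_def flow_B_def inner_add_right field)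
  moreover have "a \<bullet> xi_part (pihajoki H \<Delta>t \<zeta>) = a \<bullet> xi_part \<zeta>"
    by (rule pihajoki_preserves) (simp_all add: flow_A_def flow_B_def inner_add_right field)
  \<comment> \<open>Adding the two conservation laws cancels \<open>a \<bullet> m\<close> on each
    side.\<close>
  ultimately show ?thesis
    by (simp add: \<zeta> inner_add_right inner_diff_right)
qed

lemma inner_symmetric_matrix:
  fixes \<kappa> :: "real ^ 'n ^ 'n"
  assumes "transpose \<kappa> = \<kappa>"
  shows "x \<bullet> (\<kappa> *v y) = y \<bullet> (\<kappa> *v x)"
  using assms by (metis dot_lmul_matrix inner_commute transpose_matrix_vector)

text \<open>Pairing \<open>\<xi>\<close> with \<open>\<eta>\<close> makes the form affine in the
  part that each flow moves. The increment then involves the field and \<open>\<kappa>\<close> at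
  one and the same point, where \<open>field\<close> makes it vanish.\<close>

lemma semiexplicit_step_preserves_quadratic:
  assumes \<kappa>: "transpose \<kappa> = \<kappa>"
    and field: "\<And>w. w \<bullet> (\<kappa> *v hamiltonian_field H w) = 0"
    and step: "semiexplicit_step H \<Delta>t \<mu> z z'"
  shows "z' \<bullet> (\<kappa> *v z') = z \<bullet> (\<kappa> *v z)"
proof -
  obtain m \<zeta> where \<zeta>: "eta_part \<zeta> = z + m" "xi_part \<zeta> = z - m"
      "eta_part (pihajoki H \<Delta>t \<zeta>) = z' - m" "xi_part (pihajoki H \<Delta>t \<zeta>) = z' + m"
    using semiexplicit_step_eta_xi[OF step] .
  note bilin = inner_add_left inner_add_right inner_diff_left inner_diff_right
    matrix_vector_right_distrib matrix_vector_mult_diff_distrib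
  \<comment> \<open>\<open>flow_A\<close> moves the left factor and needs this mirrored form;
    \<open>flow_B\<close> moves the right factor and uses \<open>field\<close> itself.\<close>
  have field': "hamiltonian_field H w \<bullet> (\<kappa> *v w) = 0" for w
    using field inner_symmetric_matrix[OF \<kappa>] by metis
  have "xi_part (pihajoki H \<Delta>t \<zeta>) \<bullet> (\<kappa> *v eta_part (pihajoki H \<Delta>t \<zeta>))
      = xi_part \<zeta> \<bullet> (\<kappa> *v eta_part \<zeta>)"
    by (rule pihajoki_preserves)
      (simp_all add: flow_A_def flow_B_def bilin field field' matrix_vector_mult_scaleR)
  then show ?thesis
    \<comment> \<open>Symmetry cancels the cross terms between \<open>m\<close> and \<open>z\<close>
      or \<open>z'\<close>, leaving \<open>- (m \<bullet> (\<kappa> *v m))\<close> on both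
      sides.\<close>
    using inner_symmetric_matrix[OF \<kappa>, of m z] inner_symmetric_matrix[OF \<kappa>, of m z']
    by (simp add: \<zeta> bilin)
qed

theorem theorem1:
  fixes H :: "real ^ ('d::finite + 'd) \<Rightarrow> real"
    and \<Delta>t :: real
    and \<mu> z\<^sub>n z\<^sub>n\<^sub>1 :: "real ^ ('d + 'd)"
  assumes "smooth H"
    and "\<Delta>t > 0"
    and "semiexplicit_step H \<Delta>t \<mu> z\<^sub>n z\<^sub>n\<^sub>1"
  shows "(\<forall>a :: real ^ ('d + 'd). hamiltonian_invariant H (linear_fn a) \<longrightarrow>
            linear_fn a z\<^sub>n\<^sub>1 = linear_fn a z\<^sub>n) \<and>
         (\<forall>\<kappa> :: real ^ ('d + 'd) ^ ('d + 'd). transpose \<kappa> = \<kappa> \<longrightarrow>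
            hamiltonian_invariant H (quadratic_fn \<kappa>) \<longrightarrow>
            quadratic_fn \<kappa> z\<^sub>n\<^sub>1 = quadratic_fn \<kappa> z\<^sub>n)"
proof (intro conjI allI impI)
  fix a :: "real ^ ('d + 'd)"
  assume inv: "hamiltonian_invariant H (linear_fn a)"
  have "(linear_fn a has_derivative (\<lambda>h. a \<bullet> h)) (at w)" for w
    unfolding linear_fn_def by (auto intro!: derivative_eq_intros)
  then have "a \<bullet> hamiltonian_field H w = 0" for w
    by (rule hamiltonian_invariant_imp_derivative_zero[OF assms(1) inv])
  then show "linear_fn a z\<^sub>n\<^sub>1 = linear_fn a z\<^sub>n"
    unfolding linear_fn_def by (rule semiexplicit_step_preserves_linear[OF _ assms(3)])
next
  fix \<kappa> :: "real ^ ('d + 'd) ^ ('d + 'd)"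
  assume \<kappa>: "transpose \<kappa> = \<kappa>" and inv: "hamiltonian_invariant H (quadratic_fn \<kappa>)"
  have "(quadratic_fn \<kappa> has_derivative (\<lambda>h. 1 / 2 * (w \<bullet> (\<kappa> *v h) + h \<bullet> (\<kappa> *v w)))) (at w)" for w
    unfolding quadratic_fn_def
    by (auto intro!: derivative_eq_intros
        bounded_linear.has_derivative[OF matrix_vector_mul_bounded_linear])
  then have "1 / 2 * (w \<bullet> (\<kappa> *v hamiltonian_field H w) + hamiltonian_field H w \<bullet> (\<kappa> *v w)) = 0" for w
    by (rule hamiltonian_invariant_imp_derivative_zero[OF assms(1) inv])
  moreover have "hamiltonian_field H w \<bullet> (\<kappa> *v w) = w \<bullet> (\<kappa> *v hamiltonian_field H w)" for w
    by (rule inner_symmetric_matrix[OF \<kappa>])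
  ultimately have "w \<bullet> (\<kappa> *v hamiltonian_field H w) = 0" for w
    by simp
  then show "quadratic_fn \<kappa> z\<^sub>n\<^sub>1 = quadratic_fn \<kappa> z\<^sub>n"
    using semiexplicit_step_preserves_quadratic[OF \<kappa> _ assms(3)] by (simp add: quadratic_fn_def)
qed

end
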